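(* Let $a=c_1+c_2\mathbf{j}$ and $b=u_1+u_2\mathbf{j}$ be elements of $\mathbb{H}_s\setminus\mathbb{R}$ (with $c_1,c_2,u_1,u_2\in\mathbb{C}$) such that $a_0-b_0\neq0$ and $\det(T(a,b))=0$. Then the general solution $x\in\mathbb{H}_s$ of the linear equation $xa=bx$ is $$x=y\Big(1-\frac{2(a_0-b_0)c_2}{I_b-I_a+2(a_0-b_0)\overline{c_1}}\mathbf{j}\Big)a-\overline{b}\,y\Big(1-\frac{2(a_0-b_0)c_2}{I_b-I_a+2(a_0-b_0)\overline{c_1}}\mathbf{j}\Big),\qquad y\in\mathbb{H}_s\text{ arbitrary}.$$
   Context: $\mathbb{H}_s=\{q_0+q_1\mathbf{i}+q_2\mathbf{j}+q_3\mathbf{k}: q_i\in\mathbb{R}\}$ is the real associative algebra of split quaternions with $\mathbf{i}^2=-1$, $\mathbf{j}^2=\mathbf{k}^2=1$, $\mathbf{i}\mathbf{j}=\mathbf{k}=-\mathbf{j}\mathbf{i}$, $\mathbf{j}\mathbf{k}=-\mathbf{i}=-\mathbf{k}\mathbf{j}$, $\mathbf{k}\mathbf{i}=\mathbf{j}=-\mathbf{i}\mathbf{k}$. $\mathbb{R}+\mathbb{R}\mathbf{i}$ is identified with $\mathbb{C}$; every $q\in\mathbb{H}_s$ is uniquely $z_1+z_2\mathbf{j}$ with $z_1=q_0+q_1\mathbf{i}$, $z_2=q_2+q_3\mathbf{i}\in\mathbb{C}$. For $q\in\mathbb{H}_s$: $\overline{q}=q_0-q_1\mathbf{i}-q_2\mathbf{j}-q_3\mathbf{k}$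 and $I_q=q\overline{q}=q_0^2+q_1^2-q_2^2-q_3^2$. $a_0,b_0$ denote the real parts (coefficients of $1$) of $a,b$. $T(a,b)=R(a)-L(b)$, where $L(q)$ and $R(q)$ are the real $4\times4$ matrices, in the basis $1,\mathbf{i},\mathbf{j},\mathbf{k}$, of left multiplication $x\mapsto qx$ and right multiplication $x\mapsto xq$; so $T(a,b)$ is the matrix of the real-linear map $x\mapsto xa-bx$ on $\mathbb{H}_s$. *)

theory Defs
  imports "HOL-Analysis.Analysis"
begin

datatype split_quat = SQuat (re: real) (im_i: real) (im_j: real) (im_k: real)

instantiation split_quat :: real_algebra_1
begin

definition "0 = SQuat 0 0 0 0"
definition "1 = SQuat 1 0 0 0"
definition "x + y = SQuat (re x + re y) (im_i x + im_i y) (im_j x + im_j y) (im_k x + im_k y)"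
definition "- x = SQuat (- re x) (- im_i x) (- im_j x) (- im_k x)"
definition "x - y = SQuat (re x - re y) (im_i x - im_i y) (im_j x - im_j y) (im_k x - im_k y)"
definition "r *\<^sub>R x = SQuat (r * re x) (r * im_i x) (r * im_j x) (r * im_k x)"

(* bilinear extension of the multiplication table of the basis 1, i, j, k;
   see sq_mult_table below *)
definition "x * y = SQuat
  (re x * re y - im_i x * im_i y + im_j x * im_j y + im_k x * im_k y)
  (re x * im_i y + im_i x * re y - im_j x * im_k y + im_k x * im_j y)
  (re x * im_j y + im_j x * re y - im_i x * im_k y + im_k x * im_i y)
  (re x * im_k y + im_k x * re y + im_i x * im_j y - im_j x * im_i y)"

instance
  by standard
    (auto simp: zero_split_quat_def one_split_quat_def plus_split_quat_def
      uminus_split_quat_def minus_split_quat_def scaleR_split_quat_def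
      times_split_quat_def algebra_simps intro: split_quat.expand)

end

definition sq_i :: split_quat where "sq_i = SQuat 0 1 0 0"
definition sq_j :: split_quat where "sq_j = SQuat 0 0 1 0"
definition sq_k :: split_quat where "sq_k = SQuat 0 0 0 1"

lemma sq_mult_table:
  "sq_i * sq_i = -1" "sq_j * sq_j = 1" "sq_k * sq_k = 1"
  "sq_i * sq_j = sq_k" "sq_j * sq_i = - sq_k"
  "sq_j * sq_k = - sq_i" "sq_k * sq_j = sq_i"
  "sq_k * sq_i = sq_j" "sq_i * sq_k = - sq_j"
  by (simp_all add: sq_i_def sq_j_def sq_k_def one_split_quat_def
      uminus_split_quat_def times_split_quat_def)

lemma of_real_split_quat: "of_real r = SQuat r 0 0 0"
  by (simp add: of_real_def scaleR_split_quat_def one_split_quat_def)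

lemma split_quat_basis:
  "SQuat p q r s = of_real p + q *\<^sub>R sq_i + r *\<^sub>R sq_j + s *\<^sub>R sq_k"
  by (simp add: of_real_split_quat plus_split_quat_def scaleR_split_quat_def
      sq_i_def sq_j_def sq_k_def)

(* the identification of the complex numbers with \<real> + \<real> i *)
definition of_cplx :: "complex \<Rightarrow> split_quat" where
  "of_cplx z = SQuat (Re z) (Im z) 0 0"

lemma of_cplx_decomp:
  "\<exists>!z. q = of_cplx (fst z) + of_cplx (snd z) * sq_j"
proof
  show "q = of_cplx (fst (Complex (re q) (im_i q), Complex (im_j q) (im_k q)))
    + of_cplx (snd (Complex (re q) (im_i q), Complex (im_j q) (im_k q))) * sq_j"
    by (simp add: of_cplx_def sq_j_def plus_split_quat_def times_split_quat_def)
qed (auto simp: of_cplx_def sq_j_def plus_split_quat_def times_split_quat_def)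

definition sq_cnj :: "split_quat \<Rightarrow> split_quat" where
  "sq_cnj q = SQuat (re q) (- im_i q) (- im_j q) (- im_k q)"

(* the quadratic form I_q, as a real number *)
definition sq_form :: "split_quat \<Rightarrow> real" where
  "sq_form q = (re q)\<^sup>2 + (im_i q)\<^sup>2 - (im_j q)\<^sup>2 - (im_k q)\<^sup>2"

lemma mult_sq_cnj: "q * sq_cnj q = of_real (sq_form q)"
  by (simp add: sq_cnj_def sq_form_def of_real_split_quat times_split_quat_def power2_eq_square)

(* coordinates in the basis 1, i, j, k; the index type 4 is {1, 2, 3, 4} with 4 = 0 *)
definition sq_coords :: "split_quat \<Rightarrow> real ^ 4" where
  "sq_coords q = vector [re q, im_i q, im_j q, im_k q]"

definition sq_of_coords :: "real ^ 4 \<Rightarrow> split_quat" where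
  "sq_of_coords v = SQuat (v $ 1) (v $ 2) (v $ 3) (v $ 4)"

lemma vector_4:
  "(vector [x, y, z, w] :: real ^ 4) $ 1 = x" "(vector [x, y, z, w] :: real ^ 4) $ 2 = y"
  "(vector [x, y, z, w] :: real ^ 4) $ 3 = z" "(vector [x, y, z, w] :: real ^ 4) $ 4 = w"
  by (simp_all add: vector_def)

lemma sq_of_coords_coords: "sq_of_coords (sq_coords q) = q"
  by (simp add: sq_of_coords_def sq_coords_def vector_4)

lemma sq_coords_of_coords: "sq_coords (sq_of_coords v) = v"
  by (simp add: sq_of_coords_def sq_coords_def vector_4 vec_eq_iff forall_4)

definition sq_L :: "split_quat \<Rightarrow> real ^ 4 ^ 4" where
  "sq_L q = matrix (\<lambda>v. sq_coords (q * sq_of_coords v))"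

definition sq_R :: "split_quat \<Rightarrow> real ^ 4 ^ 4" where
  "sq_R q = matrix (\<lambda>v. sq_coords (sq_of_coords v * q))"

definition sq_T :: "split_quat \<Rightarrow> split_quat \<Rightarrow> real ^ 4 ^ 4" where
  "sq_T a b = sq_R a - sq_L b"

lemma sq_T_mult: "sq_T a b *v sq_coords x = sq_coords (x * a - b * x)"
proof -
  have L: "linear (\<lambda>v. sq_coords (q * sq_of_coords v))"
    and R: "linear (\<lambda>v. sq_coords (sq_of_coords v * q))" for q
    by (auto intro!: linearI simp: sq_coords_def sq_of_coords_def vector_4 vec_eq_iff forall_4
        times_split_quat_def algebra_simps)
  show ?thesis
    by (simp add: sq_T_def sq_L_def sq_R_def matrix_vector_mult_diff_rdistrib
        matrix_works L R sq_of_coords_coords)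
      (simp add: sq_coords_def vector_4 vec_eq_iff forall_4 minus_split_quat_def)
qed

end

theory Submission
  imports Defs
begin

text \<open>
  A common eigenvalue governs the equation. Put \<open>t = re a - re b\<close> and
  \<open>l = (sq_form a - sq_form b) / (2 * t)\<close>. Since \<open>q\<^sup>2 = 2 * re q * q - sq_form q\<close> for all \<open>q\<close>,
  comparing \<open>x * a\<^sup>2\<close> with \<open>b\<^sup>2 * x\<close> shows that \<open>x * a = b * x\<close> holds only if
  \<open>x * (a - l) = 0\<close> and \<open>(b - l) * x = 0\<close> (\<open>intertwiner_annihilates\<close>); conversely these two
  equations say \<open>x * a = l * x = b * x\<close>. The vanishing determinant supplies one solution
  \<open>x \<noteq> 0\<close>, and so \<open>a - l\<close> and \<open>b - l\<close> are zero divisors: their forms are zero. They are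
  themselves nonzero because \<open>a\<close> and \<open>b\<close> are not real.

  In terms of the denominator \<open>d\<close> of the theorem, \<open>2 * t * (a - l) = cnj d + 2 * t * c2 * j\<close>,
  so nullity of \<open>a - l\<close> means that \<open>d\<close> and \<open>2 * t * c2\<close> have the same modulus. Hence
  \<open>d \<noteq> 0\<close>, the quotient \<open>w = 2 * t * c2 / d\<close> lies on the unit circle, \<open>p = 1 - w * j\<close> is null,
  and \<open>2 * t * (a - l)\<close> is the conjugate of \<open>p\<close> times the invertible element \<open>cnj d\<close>. As \<open>p\<close>
  and its conjugate add up to \<open>2\<close>, the condition \<open>x * (a - l) = 0\<close> turns into \<open>x * p = 2 * x\<close>.
  On the other side, \<open>(b - l) * x = 0\<close> puts \<open>x\<close> into the right ideal generated by \<open>sq_cnj (b - l)\<close>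
  (\<open>null_annihilates_imp_cnj_multiple\<close>). So every solution has the form
  \<open>sq_cnj (b - l) * y * p\<close>, and all these elements are solutions, since
  \<open>(b - l) * sq_cnj (b - l) = 0\<close> and \<open>p * (a - l) = 0\<close>. Up to the sign of \<open>y\<close> this is the
  formula of the theorem, again because \<open>p * (a - l) = 0\<close>.
\<close>

lemmas split_quat_arith_defs =
  zero_split_quat_def one_split_quat_def plus_split_quat_def uminus_split_quat_def
  minus_split_quat_def scaleR_split_quat_def times_split_quat_def of_real_split_quat

lemma sq_cnj_mult: "sq_cnj q * q = of_real (sq_form q)"
  by (simp add: sq_cnj_def sq_form_def split_quat_arith_defs power2_eq_square)

lemma add_sq_cnj: "q + sq_cnj q = of_real (2 * re q)"
  by (simp add: sq_cnj_def split_quat_arith_defs)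

lemma sq_cnj_diff_of_real: "sq_cnj (q - of_real r) = sq_cnj q - of_real r"
  by (simp add: sq_cnj_def split_quat_arith_defs)

lemma sq_form_scaleR: "sq_form (r *\<^sub>R q) = r\<^sup>2 * sq_form q"
  by (simp add: sq_form_def split_quat_arith_defs power2_eq_square algebra_simps)

lemma mult_of_real_right: "(q :: split_quat) * of_real r = r *\<^sub>R q"
  by (simp add: of_real_def)

lemma mult_of_real_left: "of_real r * (q :: split_quat) = r *\<^sub>R q"
  by (simp add: of_real_def)

lemma split_quat_square: "q * q = (2 * re q) *\<^sub>R q - of_real (sq_form q)"
  by (cases q) (simp add: sq_form_def split_quat_arith_defs power2_eq_square algebra_simps)

lemma of_cplx_mult: "of_cplx u * of_cplx v = of_cplx (u * v)"
  by (simp add: of_cplx_def split_quat_arith_defs algebra_simps)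

lemma of_cplx_one: "of_cplx 1 = 1"
  by (simp add: of_cplx_def split_quat_arith_defs)

lemma of_cplx_zero: "of_cplx 0 = 0"
  by (simp add: of_cplx_def split_quat_arith_defs)

lemma sq_cnj_cplx_pair:
  "sq_cnj (of_cplx u + of_cplx v * sq_j) = of_cplx (cnj u) - of_cplx v * sq_j"
  by (simp add: of_cplx_def sq_j_def sq_cnj_def split_quat_arith_defs)

lemma sq_form_cplx_pair:
  "sq_form (of_cplx u + of_cplx v * sq_j) = (cmod u)\<^sup>2 - (cmod v)\<^sup>2"
  by (simp add: of_cplx_def sq_j_def sq_form_def split_quat_arith_defs cmod_power2)

lemma cplx_pair_mult_of_cplx:
  "(of_cplx u + of_cplx v * sq_j) * of_cplx z = of_cplx (u * z) + of_cplx (v * cnj z) * sq_j"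
  by (simp add: of_cplx_def sq_j_def split_quat_arith_defs algebra_simps)

lemma of_cplx_mult_cplx_pair:
  "of_cplx z * (of_cplx u + of_cplx v * sq_j) = of_cplx (z * u) + of_cplx (z * v) * sq_j"
  by (simp add: of_cplx_def sq_j_def split_quat_arith_defs algebra_simps)

lemma right_annihilated_imp_null:
  assumes "x * q = 0" "x \<noteq> 0"
  shows "sq_form q = 0"
proof -
  have "sq_form q *\<^sub>R x = x * q * sq_cnj q"
    by (simp add: mult.assoc mult_sq_cnj mult_of_real_right)
  then show ?thesis using assms by simp
qed

lemma left_annihilated_imp_null:
  assumes "q * x = 0" "x \<noteq> 0"
  shows "sq_form q = 0"
proof -
  have "sq_form q *\<^sub>R x = sq_cnj q * (q * x)"
    by (simp flip: mult.assoc add: sq_cnj_mult mult_of_real_left)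
  then show ?thesis using assms by simp
qed

text \<open>
  For a nonzero complex part \<open>u\<close> of \<open>q\<close> there is a Bezout relation
  \<open>sq_cnj q * s + s' * q = 1\<close> with the complex coefficients \<open>s = 1 / (2 * cnj u)\<close> and
  \<open>s' = 1 / (2 * u)\<close>: the complex parts give one half each, and the \<open>j\<close> parts cancel because
  moving \<open>s\<close> past \<open>j\<close> conjugates it. Nullity
  gives the two parts of \<open>q\<close> the same modulus, and so \<open>q \<noteq> 0\<close> forces \<open>u \<noteq> 0\<close>.
\<close>
lemma null_annihilates_imp_cnj_multiple:
  assumes "sq_form q = 0" "q \<noteq> 0" "q * x = 0"
  obtains u where "x = sq_cnj q * u"
proof -
  obtain u v where q: "q = of_cplx u + of_cplx v * sq_j"
    using of_cplx_decomp[of q] by blast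
  have "cmod u = cmod v"
    using assms(1) by (simp add: q sq_form_cplx_pair)
  then have u: "u \<noteq> 0"
    using assms(2) by (auto simp: q of_cplx_zero)
  have "sq_cnj q = of_cplx (cnj u) + of_cplx (- v) * sq_j"
    unfolding q sq_cnj_cplx_pair
    by (simp add: of_cplx_def sq_j_def split_quat_arith_defs)
  then have bezout: "sq_cnj q * of_cplx (1 / (2 * cnj u)) + of_cplx (1 / (2 * u)) * q = 1"
    using u unfolding q
    by (simp only: cplx_pair_mult_of_cplx of_cplx_mult_cplx_pair)
      (simp add: of_cplx_def sq_j_def split_quat_arith_defs)
  have "x = (sq_cnj q * of_cplx (1 / (2 * cnj u)) + of_cplx (1 / (2 * u)) * q) * x"
    by (simp only: bezout mult_1_left)
  also have "\<dots> = sq_cnj q * (of_cplx (1 / (2 * cnj u)) * x)"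
    using assms(3) by (simp add: distrib_right mult.assoc)
  finally show thesis by (rule that)
qed

text \<open>
  The real number that is subtracted is the only possible common root of the polynomials
  \<open>X\<^sup>2 - 2 * re q * X + sq_form q\<close> for \<open>q = a\<close> and \<open>q = b\<close>. These annihilate \<open>a\<close> and \<open>b\<close>, and
  applying their difference to \<open>x * a = b * x\<close> leaves a linear equation.
\<close>
lemma intertwiner_annihilates:
  fixes a b x :: split_quat
  defines "l \<equiv> (sq_form a - sq_form b) / (2 * (re a - re b))"
  assumes eq: "x * a = b * x" and t: "re a - re b \<noteq> 0"
  shows "x * (a - of_real l) = 0" "(b - of_real l) * x = 0"
proof -
  have "x * (a * a) = b * b * x"
    by (metis eq mult.assoc)
  then have "(2 * re a) *\<^sub>R (x * a) - sq_form a *\<^sub>R x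
      = (2 * re b) *\<^sub>R (x * a) - sq_form b *\<^sub>R x"
    by (simp add: split_quat_square right_diff_distrib left_diff_distrib
        mult_of_real_left mult_of_real_right eq)
  then have "(2 * (re a - re b)) *\<^sub>R (x * a) = (sq_form a - sq_form b) *\<^sub>R x"
    by (simp add: algebra_simps)
  also have "\<dots> = (2 * (re a - re b)) *\<^sub>R (l *\<^sub>R x)"
    using t by (simp add: l_def)
  finally have xa: "x * a = l *\<^sub>R x"
    using t unfolding scaleR_cancel_left by simp
  show "x * (a - of_real l) = 0"
    by (simp add: right_diff_distrib mult_of_real_right xa)
  show "(b - of_real l) * x = 0"
    by (simp add: left_diff_distrib mult_of_real_left eq[symmetric] xa)
qed

lemma det_sq_T_zero_imp_intertwiner:
  assumes "det (sq_T a b) = 0"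
  obtains x where "x \<noteq> 0" "x * a = b * x"
proof -
  obtain v where v: "v \<noteq> 0" "sq_T a b *v v = 0"
    using assms invertible_det_nz[of "sq_T a b"] invertible_left_inverse
      matrix_left_invertible_ker by blast
  define x where "x = sq_of_coords v"
  have coords_0: "sq_coords 0 = 0" "sq_of_coords 0 = 0"
    by (simp_all add: sq_coords_def sq_of_coords_def zero_split_quat_def
        vec_eq_iff forall_4 vector_4)
  have "x \<noteq> 0"
    using v(1) coords_0(1) sq_coords_of_coords[of v] by (auto simp: x_def)
  moreover have "sq_coords (x * a - b * x) = 0"
    using v(2) by (simp add: x_def sq_T_mult[symmetric] sq_coords_of_coords)
  then have "x * a - b * x = 0"
    using coords_0(2) sq_of_coords_coords[of "x * a - b * x"] by simp
  ultimately show thesis using that by simp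
qed

theorem theorem4p2:
  fixes a b :: split_quat and c1 c2 u1 u2 :: complex
  assumes "a = of_cplx c1 + of_cplx c2 * sq_j"
    and "b = of_cplx u1 + of_cplx u2 * sq_j"
    and "a \<notin> \<real>" and "b \<notin> \<real>"
    and "re a - re b \<noteq> 0"
    and "det (sq_T a b) = 0"
  shows "let d = complex_of_real (sq_form b - sq_form a) + 2 * complex_of_real (re a - re b) * cnj c1;
             p = 1 - of_cplx (2 * complex_of_real (re a - re b) * c2 / d) * sq_j
         in d \<noteq> 0 \<and> (\<forall>x. x * a = b * x \<longleftrightarrow> (\<exists>y. x = y * p * a - sq_cnj b * y * p))"
proof -
  define t where "t = re a - re b"
  define l where "l = (sq_form a - sq_form b) / (2 * t)"
  define d where "d = complex_of_real (sq_form b - sq_form a) + 2 * complex_of_real t * cnj c1"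
  define w where "w = 2 * complex_of_real t * c2 / d"
  define p where "p = 1 - of_cplx w * sq_j"
  define a' where "a' = a - of_real l"
  define b' where "b' = b - of_real l"
  have t: "t \<noteq> 0" using assms(5) by (simp add: t_def)
  have ann: "x * a' = 0" "b' * x = 0" if "x * a = b * x" for x
    using intertwiner_annihilates[OF that assms(5)] by (simp_all add: a'_def b'_def l_def t_def)
  obtain x0 where "x0 \<noteq> 0" "x0 * a = b * x0"
    using det_sq_T_zero_imp_intertwiner[OF assms(6)] .
  then have null: "sq_form a' = 0" "sq_form b' = 0"
    using ann right_annihilated_imp_null left_annihilated_imp_null by blast+
  have "a' \<noteq> 0" "b' \<noteq> 0"
    using assms(3,4) by (auto simp: a'_def b'_def)

  have tl: "2 * t * l = sq_form a - sq_form b"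
    using t by (simp add: l_def)
  have "(2 * t) *\<^sub>R a' = (2 * t) *\<^sub>R a - of_real (sq_form a - sq_form b)"
    by (simp add: a'_def scaleR_diff_right of_real_def tl)
  also have "\<dots> = of_cplx (cnj d) + of_cplx (2 * complex_of_real t * c2) * sq_j"
    unfolding d_def by (subst assms(1)) (simp add: of_cplx_def sq_j_def split_quat_arith_defs)
  finally have a'_pair:
    "(2 * t) *\<^sub>R a' = of_cplx (cnj d) + of_cplx (2 * complex_of_real t * c2) * sq_j" .
  have "sq_form ((2 * t) *\<^sub>R a') = 0"
    by (simp add: sq_form_scaleR null)
  then have cmod_eq: "cmod d = cmod (2 * complex_of_real t * c2)"
    unfolding a'_pair sq_form_cplx_pair by simp
  have d: "d \<noteq> 0"
  proof
    assume "d = 0"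
    then have "(2 * t) *\<^sub>R a' = 0"
      using a'_pair cmod_eq by (auto simp: of_cplx_zero)
    then show False using t \<open>a' \<noteq> 0\<close> by simp
  qed
  then have "cmod w = 1"
    by (simp add: w_def norm_divide flip: cmod_eq)

  have p_pair: "p = of_cplx 1 + of_cplx (- w) * sq_j"
    by (simp add: p_def of_cplx_def sq_j_def split_quat_arith_defs)
  have cnj_p: "sq_cnj p = of_cplx 1 + of_cplx w * sq_j"
    unfolding p_pair sq_cnj_cplx_pair by (simp add: of_cplx_def sq_j_def split_quat_arith_defs)
  have "sq_form p = 0"
    using \<open>cmod w = 1\<close> by (simp only: p_pair sq_form_cplx_pair) simp
  then have p_cnj_p: "p * sq_cnj p = 0"
    by (simp add: mult_sq_cnj)
  have "re p = 1"
    by (simp add: p_def of_cplx_def sq_j_def split_quat_arith_defs)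
  then have p_add: "p + sq_cnj p = 2"
    by (simp add: add_sq_cnj)
  have a'_factor: "(2 * t) *\<^sub>R a' = sq_cnj p * of_cplx (cnj d)"
    using d by (simp add: a'_pair cnj_p cplx_pair_mult_of_cplx w_def)
  have "(2 * t) *\<^sub>R (p * a') = p * sq_cnj p * of_cplx (cnj d)"
    by (metis a'_factor mult_scaleR_right mult.assoc)
  then have pa': "p * a' = 0"
    using t by (simp add: p_cnj_p)

  \<comment> \<open>The shift by \<open>l\<close> cancels between the two terms, and \<open>p\<close> kills the first of them.\<close>
  have formula: "y * p * a - sq_cnj b * y * p = - (sq_cnj b' * y * p)" for y
  proof -
    have "y * p * a - sq_cnj b * y * p = y * (p * a') - sq_cnj b' * y * p"
      by (simp add: a'_def b'_def sq_cnj_diff_of_real right_diff_distrib left_diff_distrib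
          mult_of_real_left mult_of_real_right mult.assoc)
    then show ?thesis by (simp add: pa')
  qed

  have "x * a = b * x \<longleftrightarrow> (\<exists>y. x = y * p * a - sq_cnj b * y * p)" for x
  proof
    assume "x * a = b * x"
    note ann = ann[OF this]
    have "x * sq_cnj p * of_cplx (cnj d) = 0"
      using ann(1) by (simp add: mult.assoc flip: a'_factor)
    then have "x * sq_cnj p * (of_cplx (cnj d) * of_cplx (1 / cnj d)) = 0"
      by (simp flip: mult.assoc)
    then have "x * sq_cnj p = 0"
      using d by (simp add: of_cplx_mult of_cplx_one)
    then have "x * p = x * (p + sq_cnj p)"
      by (simp add: distrib_left)
    then have xp: "x * p = 2 *\<^sub>R x"
      using mult_of_real_right[of x 2] by (simp add: p_add)
    obtain u where u: "x = sq_cnj b' * u"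
      using null_annihilates_imp_cnj_multiple[OF null(2) \<open>b' \<noteq> 0\<close> ann(2)] .
    have "x = - (sq_cnj b' * ((- 1 / 2) *\<^sub>R u) * p)"
      using xp by (simp flip: u)
    then show "\<exists>y. x = y * p * a - sq_cnj b * y * p"
      unfolding formula ..
  next
    assume "\<exists>y. x = y * p * a - sq_cnj b * y * p"
    then obtain y where y: "x = - (sq_cnj b' * y * p)"
      unfolding formula ..
    have "x * a' = 0"
      by (simp add: y mult.assoc pa')
    moreover have "b' * x = - (b' * sq_cnj b' * y * p)"
      by (simp add: y mult.assoc)
    then have "b' * x = 0"
      by (simp add: mult_sq_cnj null)
    ultimately show "x * a = b * x"
      by (simp add: a'_def b'_def right_diff_distrib left_diff_distrib
          mult_of_real_left mult_of_real_right)
  qed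
  with d show ?thesis
    unfolding Let_def d_def p_def w_def t_def by blast
qed

end
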